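(* There are absolute constants $c,C>0$ such that, for all integers $N\ge2$ and all real $r\geq\sqrt2$ with $$r(\log N)^2\leq cN,$$ one has, uniformly in $q$ (that is, for every integer $1\le q\le\binom N2$), $$|\mathcal A_{N,q}(r)|\leq2^{CrN(\log N)^2}.$$
   Context: All logarithms are natural. For integers $N\geq2$, $1\leq q\leq\binom N2$ and real $r>0$, $\mathcal A_{N,q}(r)$ denotes the set of adjacency matrices ($N\times N$ matrices with entries in $\{0,1\}$, symmetric, zero diagonal, indexed by $\mathbb Z_N=\mathbb Z/N\mathbb Z$) of labeled simple graphs on the vertex set $\mathbb Z_N$ with exactly $q$ edges and Fourier ratio at most $r$. The Fourier ratio of a nonzero $N\times N$ matrix $A$ is $\operatorname{FR}(A)=\|FAF\|_1/\|FAF\|_2$, where $F$ is the unitary Fourier matrix $F_{mx}=\frac1{\sqrt N}e^{-2\pi i mx/N}$, $\|\cdot\|_1$ is the entrywise $\ell^1$-norm and $\|\cdot\|_2$ is the Frobenius norm. *)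

theory Defs
  imports Complex_Main "Jordan_Normal_Form.Matrix"
begin

text \<open>The group Z/NZ is represented by the residues 0, ..., N - 1, which index the rows and
  columns of an N x N matrix.\<close>

definition fourier_mat :: "nat \<Rightarrow> complex mat" where
  "fourier_mat N = mat N N (\<lambda>(m, x).
     1 / of_real (sqrt (real N)) *
     exp (- 2 * of_real pi * \<i> * of_nat m * of_nat x / of_nat N))"

definition entrywise_l1_norm :: "complex mat \<Rightarrow> real" where
  "entrywise_l1_norm A = (\<Sum>i<dim_row A. \<Sum>j<dim_col A. cmod (A $$ (i, j)))"

definition frobenius_norm :: "complex mat \<Rightarrow> real" where
  "frobenius_norm A = sqrt (\<Sum>i<dim_row A. \<Sum>j<dim_col A. (cmod (A $$ (i, j)))\<^sup>2)"

text \<open>Meaningful for nonzero square matrices only; by the convention for division by zero, the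
  zero matrix gets the value 0.\<close>

definition fourier_ratio :: "complex mat \<Rightarrow> real" where
  "fourier_ratio A =
     (let F = fourier_mat (dim_row A); B = F * A * F
      in entrywise_l1_norm B / frobenius_norm B)"

definition is_adjacency_mat :: "nat \<Rightarrow> complex mat \<Rightarrow> bool" where
  "is_adjacency_mat N A \<longleftrightarrow>
     A \<in> carrier_mat N N \<and>
     (\<forall>i<N. \<forall>j<N. A $$ (i, j) \<in> {0, 1}) \<and>
     transpose_mat A = A \<and>
     (\<forall>i<N. A $$ (i, i) = 0)"

definition graph_edges :: "complex mat \<Rightarrow> nat set set" where
  "graph_edges A = {{i, j} | i j. i < dim_row A \<and> j < dim_col A \<and> A $$ (i, j) = 1}"

definition low_FR_graphs :: "nat \<Rightarrow> nat \<Rightarrow> real \<Rightarrow> complex mat set" where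
  "low_FR_graphs N q r =
     {A. is_adjacency_mat N A \<and> card (graph_edges A) = q \<and> fourier_ratio A \<le> r}"

text \<open>Finiteness, so that \<^const>\<open>card\<close> of this set is the true cardinality.\<close>

lemma finite_low_FR_graphs: "finite (low_FR_graphs N q r)"
proof -
  let ?S = "{..<N} \<times> {..<N}"
  let ?f = "\<lambda>E. mat N N (\<lambda>p. if p \<in> E then 1 else 0) :: complex mat"
  have "low_FR_graphs N q r \<subseteq> ?f ` Pow ?S"
  proof
    fix A assume "A \<in> low_FR_graphs N q r"
    then have A: "is_adjacency_mat N A" by (simp add: low_FR_graphs_def)
    have "A = ?f {p \<in> ?S. A $$ p = 1}"
      using A by (intro eq_matI) (auto simp: is_adjacency_mat_def)
    then show "A \<in> ?f ` Pow ?S" by blast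
  qed
  then show ?thesis by (rule finite_subset) simp
qed

end

theory Submission
  imports Defs
begin

text \<open>Round the real and imaginary parts of the entries of \<open>B = F A F\<close> towards zero. By
  Parseval the \<open>\<ell>\<^sup>1\<close>-norm of \<open>B\<close> is at most \<open>r N\<close>, hence the rounded entries form an integer
  vector of \<open>\<ell>\<^sup>1\<close>-norm at most \<open>2 r N\<close>, and there are only \<open>N\<^bsup>O(r N)\<^esup>\<close> of these. Two graphs
  with the same rounded vector satisfy \<open>\<parallel>B - B'\<parallel>\<^sub>2\<^sup>2 \<le> 8 r N\<close>, because two reals with
  the same rounding differ by at most 2 and by at most the sum of their absolute values; by
  Parseval again their adjacency matrices differ in at most \<open>8 r N\<close> entries, which leaves
  \<open>N\<^bsup>O(r N)\<^esup>\<close> graphs per vector.\<close>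

section \<open>Counting integer vectors of bounded l1-norm\<close>

text \<open>Vanishing off \<open>I\<close> makes each integer vector indexed by \<open>I\<close>
  correspond to exactly one function, so that \<open>card\<close> counts vectors.\<close>

definition int_l1_ball :: "'a set \<Rightarrow> nat \<Rightarrow> ('a \<Rightarrow> int) set" where
  "int_l1_ball I K = {f. (\<forall>i. i \<notin> I \<longrightarrow> f i = 0) \<and> (\<Sum>i\<in>I. \<bar>f i\<bar>) \<le> int K}"

text \<open>Moving a nonzero coordinate one unit towards zero lowers the norm by 1.
  \<open>Some (i, s)\<close> undoes such a move; \<open>None\<close> covers the zero vector.\<close>

lemma int_l1_ball_Suc_subset:
  assumes "finite I"
  shows "int_l1_ball I (Suc K) \<subseteq>
    (\<lambda>(g, u). case u of None \<Rightarrow> g | Some (i, s) \<Rightarrow> g(i := g i + s)) `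
      (int_l1_ball I K \<times> insert None (Some ` (I \<times> {1, -1})))"
    (is "_ \<subseteq> ?h ` ?D")
proof
  fix f assume f: "f \<in> int_l1_ball I (Suc K)"
  show "f \<in> ?h ` ?D"
  proof (cases "\<exists>i\<in>I. f i \<noteq> 0")
    case False
    then have "f \<in> int_l1_ball I K" using f by (auto simp: int_l1_ball_def)
    then show ?thesis by (intro image_eqI[of _ _ "(f, None)"]) auto
  next
    case True
    then obtain i where i: "i \<in> I" "f i \<noteq> 0" by blast
    define g where "g = f(i := f i - sgn (f i))"
    have "(\<Sum>j\<in>I. \<bar>g j\<bar>) = \<bar>g i\<bar> + (\<Sum>j\<in>I - {i}. \<bar>g j\<bar>)"
      using assms i by (simp add: sum.remove)
    also have "(\<Sum>j\<in>I - {i}. \<bar>g j\<bar>) = (\<Sum>j\<in>I - {i}. \<bar>f j\<bar>)"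
      by (rule sum.cong) (auto simp: g_def)
    also have "\<bar>g i\<bar> = \<bar>f i\<bar> - 1" using i(2) by (auto simp: g_def sgn_if)
    also have "\<bar>f i\<bar> - 1 + (\<Sum>j\<in>I - {i}. \<bar>f j\<bar>) = (\<Sum>j\<in>I. \<bar>f j\<bar>) - 1"
      using assms i by (simp add: sum.remove)
    finally have "g \<in> int_l1_ball I K"
      using f i by (auto simp: int_l1_ball_def g_def)
    moreover have "f = ?h (g, Some (i, sgn (f i)))" by (auto simp: g_def)
    moreover have "sgn (f i) \<in> {1, -1}" using i(2) by (auto simp: sgn_if)
    ultimately show ?thesis using i by blast
  qed
qed

text \<open>Every vector in the ball is reached from zero in \<open>K\<close> moves with
  \<open>2 * card I + 1\<close> choices each: a coordinate and a sign, or standing still.\<close>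

lemma finite_card_int_l1_ball:
  assumes "finite I"
  shows "finite (int_l1_ball I K) \<and> card (int_l1_ball I K) \<le> (2 * card I + 1) ^ K"
proof (induction K)
  case 0
  have "int_l1_ball I 0 \<subseteq> {\<lambda>_. 0}"
  proof
    fix f assume f: "f \<in> int_l1_ball I 0"
    then have "(\<Sum>i\<in>I. \<bar>f i\<bar>) = 0"
      by (intro antisym sum_nonneg) (auto simp: int_l1_ball_def)
    then have "\<forall>i\<in>I. f i = 0" using assms by (simp add: sum_nonneg_eq_0_iff)
    then show "f \<in> {\<lambda>_. 0}" using f by (auto simp: int_l1_ball_def)
  qed
  then have "finite (int_l1_ball I 0)" "card (int_l1_ball I 0) \<le> card {\<lambda>_ :: 'a. 0 :: int}"
    by (blast intro: finite_subset, intro card_mono) auto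
  then show ?case by simp
next
  case (Suc K)
  let ?U = "insert None (Some ` (I \<times> {1, -1 :: int}))"
  let ?D = "int_l1_ball I K \<times> ?U"
  have fin: "finite ?D" using Suc assms by auto
  have "card (Some ` (I \<times> {1, -1 :: int})) = 2 * card I"
    by (subst card_image) (auto simp: card_cartesian_product)
  moreover have "None \<notin> Some ` (I \<times> {1, -1 :: int})" by blast
  ultimately have "card ?U = 2 * card I + 1" using assms by simp
  then have card_D: "card ?D \<le> (2 * card I + 1) ^ Suc K"
    unfolding card_cartesian_product power_Suc2 using Suc by (intro mult_le_mono) auto
  have "finite (int_l1_ball I (Suc K))"
    using finite_subset[OF int_l1_ball_Suc_subset[OF assms]] fin by blast
  moreover have "card (int_l1_ball I (Suc K)) \<le> card ?D"
    using surj_card_le[OF fin int_l1_ball_Suc_subset[OF assms]] .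
  ultimately show ?case using card_D by linarith
qed

section \<open>Rounding towards zero\<close>

text \<open>Unlike the floor, this rounding never increases the absolute value, so an l1-bound
  passes to the rounded vector.\<close>

definition trunc :: "real \<Rightarrow> int" where
  "trunc x = (if x \<ge> 0 then \<lfloor>x\<rfloor> else - \<lfloor>- x\<rfloor>)"

lemma abs_trunc_le: "real_of_int \<bar>trunc x\<bar> \<le> \<bar>x\<bar>"
proof (cases "x \<ge> 0")
  case True
  then show ?thesis by (simp add: trunc_def)
next
  case False
  then have "\<lfloor>- x\<rfloor> \<ge> 0" by simp
  then have "\<bar>- \<lfloor>- x\<rfloor>\<bar> = \<lfloor>- x\<rfloor>" by simp
  moreover have "real_of_int \<lfloor>- x\<rfloor> \<le> \<bar>x\<bar>" using False by linarith
  ultimately show ?thesis using False by (simp only: trunc_def if_False)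
qed

lemma trunc_eq_imp_sq_diff_le:
  assumes "trunc x = trunc y"
  shows "(x - y)\<^sup>2 \<le> 2 * (\<bar>x\<bar> + \<bar>y\<bar>)"
proof -
  \<comment> \<open>The extreme case is the fibre of 0, the interval from -1 to 1; all other fibres
    have length 1.\<close>
  have "\<bar>x - y\<bar> \<le> 2" using assms unfolding trunc_def by (auto split: if_splits; linarith)
  moreover have "\<bar>x - y\<bar> \<le> \<bar>x\<bar> + \<bar>y\<bar>" by simp
  ultimately have "\<bar>x - y\<bar> * \<bar>x - y\<bar> \<le> 2 * (\<bar>x\<bar> + \<bar>y\<bar>)"
    by (intro mult_mono) auto
  then show ?thesis by (simp add: power2_eq_square)
qed

section \<open>Orthogonality of characters and Parseval's identity\<close>

text \<open>The phase is grouped as \<open>m\<close> times an angle, the shape in which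
  \<open>DeMoivre\<close> turns it into an \<open>m\<close>-th power.\<close>

definition fourier_coeff :: "nat \<Rightarrow> nat \<Rightarrow> nat \<Rightarrow> complex" where
  "fourier_coeff N m x =
     cis (- (real m * (2 * pi * real x / real N))) / of_real (sqrt (real N))"

lemma fourier_mat_index:
  assumes "m < N" "x < N"
  shows "fourier_mat N $$ (m, x) = fourier_coeff N m x"
proof -
  have "exp (- 2 * of_real pi * \<i> * of_nat m * of_nat x / of_nat N)
    = cis (- (real m * (2 * pi * real x / real N)))"
    by (simp add: cis_conv_exp mult_ac)
  then show ?thesis using assms by (simp add: fourier_mat_def fourier_coeff_def)
qed

lemma fourier_coeff_sym: "fourier_coeff N m x = fourier_coeff N x m"
  unfolding fourier_coeff_def by (simp add: mult_ac)

text \<open>The sum is geometric, with ratio a quotient \<open>z\<close> of two \<open>N\<close>-th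
  roots of unity, and \<open>z = 1\<close> only if \<open>x = y\<close>.\<close>

lemma fourier_coeff_orthonormal:
  assumes "x < N" "y < N"
  shows "(\<Sum>m<N. fourier_coeff N m x * cnj (fourier_coeff N m y)) = (if x = y then 1 else 0)"
proof -
  let ?w = "\<lambda>x. cis (2 * pi * real x / real N)"
  define z where "z = ?w y / ?w x"
  have N: "N > 0" using assms by simp
  have s: "of_real (sqrt (real N)) * of_real (sqrt (real N)) = (of_nat N :: complex)"
    by (simp flip: of_real_mult)
  have summand: "fourier_coeff N m x * cnj (fourier_coeff N m y) = z ^ m / of_nat N" for m
    by (simp add: fourier_coeff_def z_def cis_cnj s cis_mult cis_divide DeMoivre algebra_simps)
  have w_pow: "?w k ^ N = 1" for k
    using N by (simp add: DeMoivre cis_multiple_2pi)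
  have zN: "z ^ N = 1"
    by (simp add: z_def power_divide w_pow)
  show ?thesis
  proof (cases "x = y")
    case True
    then have "z = 1" by (simp add: z_def)
    then show ?thesis unfolding summand using True N by simp
  next
    case False
    have "z \<noteq> 1"
    proof
      assume "z = 1"
      then have "?w x = ?w y" by (simp add: z_def)
      then show False
        using bij_betw_roots_unity[OF N] assms False by (auto simp: bij_betw_def inj_on_def)
    qed
    then have "(\<Sum>m<N. z ^ m) = 0" by (simp add: geometric_sum zN)
    then show ?thesis using False by (simp add: summand flip: sum_divide_distrib)
  qed
qed

text \<open>Expanding each squared modulus as a product with the conjugate and summing over
  \<open>m\<close> first leaves only the diagonal terms, by orthonormality.\<close>

lemma fourier_coeff_Parseval:
  "(\<Sum>m<N. (cmod (\<Sum>x<N. fourier_coeff N m x * v x))\<^sup>2) = (\<Sum>x<N. (cmod (v x))\<^sup>2)"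
proof -
  let ?f = "fourier_coeff N"
  have "complex_of_real (\<Sum>m<N. (cmod (\<Sum>x<N. ?f m x * v x))\<^sup>2)
    = (\<Sum>m<N. \<Sum>x<N. \<Sum>y<N. (?f m x * v x) * cnj (?f m y * v y))"
    by (simp only: of_real_sum complex_norm_square cnj_sum sum_product)
  also have "\<dots> = (\<Sum>x<N. \<Sum>m<N. \<Sum>y<N. (?f m x * v x) * cnj (?f m y * v y))"
    by (rule sum.swap)
  also have "\<dots> = (\<Sum>x<N. \<Sum>y<N. \<Sum>m<N. (?f m x * v x) * cnj (?f m y * v y))"
    by (intro sum.cong refl sum.swap)
  also have "\<dots> = (\<Sum>x<N. \<Sum>y<N. v x * cnj (v y) * (\<Sum>m<N. ?f m x * cnj (?f m y)))"
    by (simp add: sum_distrib_left mult_ac)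
  also have "\<dots> = (\<Sum>x<N. \<Sum>y<N. v x * cnj (v y) * (if x = y then 1 else 0))"
    by (intro sum.cong refl arg_cong2[of _ _ _ _ "(*)"] fourier_coeff_orthonormal) auto
  also have "\<dots> = complex_of_real (\<Sum>x<N. (cmod (v x))\<^sup>2)"
    by (simp only: of_real_sum complex_norm_square) (simp add: if_distrib sum.delta cong: if_cong)
  finally show ?thesis by (simp only: of_real_eq_iff)
qed

text \<open>This is the entry of \<open>F A F\<close>, with the symmetry of \<open>F\<close> used to
  write \<open>fourier_coeff N j y\<close>, so that both sums are one-dimensional
  transforms.\<close>

definition fourier2 :: "nat \<Rightarrow> (nat \<Rightarrow> nat \<Rightarrow> complex) \<Rightarrow> nat \<Rightarrow> nat \<Rightarrow> complex" where
  "fourier2 N a i j = (\<Sum>y<N. fourier_coeff N j y * (\<Sum>x<N. fourier_coeff N i x * a x y))"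

lemma fourier2_Parseval:
  "(\<Sum>i<N. \<Sum>j<N. (cmod (fourier2 N a i j))\<^sup>2) = (\<Sum>x<N. \<Sum>y<N. (cmod (a x y))\<^sup>2)"
proof -
  have "(\<Sum>i<N. \<Sum>j<N. (cmod (fourier2 N a i j))\<^sup>2)
    = (\<Sum>i<N. \<Sum>y<N. (cmod (\<Sum>x<N. fourier_coeff N i x * a x y))\<^sup>2)"
    unfolding fourier2_def by (simp only: fourier_coeff_Parseval)
  also have "\<dots> = (\<Sum>y<N. \<Sum>i<N. (cmod (\<Sum>x<N. fourier_coeff N i x * a x y))\<^sup>2)"
    by (rule sum.swap)
  also have "\<dots> = (\<Sum>y<N. \<Sum>x<N. (cmod (a x y))\<^sup>2)"
    by (simp only: fourier_coeff_Parseval)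
  also have "\<dots> = (\<Sum>x<N. \<Sum>y<N. (cmod (a x y))\<^sup>2)" by (rule sum.swap)
  finally show ?thesis .
qed

lemma fourier2_diff:
  "fourier2 N a i j - fourier2 N b i j = fourier2 N (\<lambda>x y. a x y - b x y) i j"
  by (simp add: fourier2_def right_diff_distrib sum_subtractf)

lemma fourier_mat_conj_index:
  assumes "A \<in> carrier_mat N N" "i < N" "j < N"
  shows "(fourier_mat N * A * fourier_mat N) $$ (i, j) = fourier2 N (\<lambda>x y. A $$ (x, y)) i j"
proof -
  have F: "fourier_mat N \<in> carrier_mat N N" by (simp add: fourier_mat_def)
  have "(fourier_mat N * A * fourier_mat N) $$ (i, j)
    = (\<Sum>y<N. (\<Sum>x<N. fourier_coeff N i x * A $$ (x, y)) * fourier_coeff N y j)"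
    using assms F
    by (simp add: scalar_prod_def fourier_mat_index lessThan_atLeast0 del: assoc_mult_mat)
  also have "\<dots> = fourier2 N (\<lambda>x y. A $$ (x, y)) i j"
    by (simp add: fourier2_def fourier_coeff_sym[of N j] mult.commute)
  finally show ?thesis .
qed

section \<open>Spectra of graphs of low Fourier ratio\<close>

text \<open>The l1-norm is at most \<open>r\<close> times the Frobenius norm, which by Parseval is
  that of a 0/1 matrix and hence at most \<open>N\<close>.\<close>

lemma l1_fourier2_le:
  assumes A: "is_adjacency_mat N A" and FR: "fourier_ratio A \<le> r" and r: "r \<ge> 0"
  shows "(\<Sum>i<N. \<Sum>j<N. cmod (fourier2 N (\<lambda>x y. A $$ (x, y)) i j)) \<le> r * real N"
proof -
  let ?B = "fourier2 N (\<lambda>x y. A $$ (x, y))"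
  let ?L = "\<Sum>i<N. \<Sum>j<N. cmod (?B i j)"
  let ?Q = "\<Sum>i<N. \<Sum>j<N. (cmod (?B i j))\<^sup>2"
  have carr: "A \<in> carrier_mat N N" using A by (simp add: is_adjacency_mat_def)
  have "dim_row (fourier_mat N) = N" "dim_col (fourier_mat N) = N"
    by (simp_all add: fourier_mat_def)
  then have ratio: "fourier_ratio A = ?L / sqrt ?Q"
    using carr by (simp add: fourier_ratio_def entrywise_l1_norm_def frobenius_norm_def Let_def
        fourier_mat_conj_index del: index_mult_mat(1))
  have "?Q = (\<Sum>x<N. \<Sum>y<N. (cmod (A $$ (x, y)))\<^sup>2)" by (rule fourier2_Parseval)
  also have "\<dots> \<le> (\<Sum>x<N. \<Sum>y<N. 1)"
    using A by (intro sum_mono) (fastforce simp: is_adjacency_mat_def)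
  finally have "?Q \<le> (real N)\<^sup>2" by (simp add: power2_eq_square)
  then have Q: "sqrt ?Q \<le> real N" by (simp add: real_le_lsqrt)
  show ?thesis
  proof (cases "?Q = 0")
    \<comment> \<open>Here the ratio is 0 by the division convention and says nothing about the
      numerator, but all entries vanish.\<close>
    case True
    then have "\<forall>i<N. \<forall>j<N. ?B i j = 0"
      by (simp add: sum_nonneg_eq_0_iff sum_nonneg)
    then show ?thesis using r by simp
  next
    case False
    moreover have "?Q \<ge> 0" by (intro sum_nonneg) auto
    ultimately have "?L \<le> r * sqrt ?Q" using FR by (simp add: ratio divide_le_eq)
    also have "\<dots> \<le> r * real N" using Q r by (rule mult_left_mono)
    finally show ?thesis .
  qed
qed

text \<open>The Boolean selects the real or the imaginary part.\<close>

definition rounded_spectrum :: "nat \<Rightarrow> complex mat \<Rightarrow> nat \<times> nat \<times> bool \<Rightarrow> int" where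
  "rounded_spectrum N A = (\<lambda>(i, j, b). if i < N \<and> j < N
     then trunc ((if b then Re else Im) (fourier2 N (\<lambda>x y. A $$ (x, y)) i j)) else 0)"

lemma rounded_spectrum_in_ball:
  assumes "is_adjacency_mat N A" "fourier_ratio A \<le> r" "r \<ge> 0"
  shows "rounded_spectrum N A \<in>
    int_l1_ball ({..<N} \<times> {..<N} \<times> UNIV) (nat \<lfloor>2 * r * real N\<rfloor>)"
proof -
  let ?B = "fourier2 N (\<lambda>x y. A $$ (x, y))"
  let ?R = "rounded_spectrum N A"
  have "real_of_int (\<Sum>p\<in>{..<N} \<times> {..<N} \<times> UNIV. \<bar>?R p\<bar>)
    = (\<Sum>i<N. \<Sum>j<N. real_of_int \<bar>trunc (Re (?B i j))\<bar> + real_of_int \<bar>trunc (Im (?B i j))\<bar>)"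
    by (simp add: sum.cartesian_product' rounded_spectrum_def UNIV_bool add.commute)
  also have "\<dots> \<le> (\<Sum>i<N. \<Sum>j<N. 2 * cmod (?B i j))"
  proof (intro sum_mono)
    fix i j
    show "real_of_int \<bar>trunc (Re (?B i j))\<bar> + real_of_int \<bar>trunc (Im (?B i j))\<bar>
      \<le> 2 * cmod (?B i j)"
      using abs_trunc_le[of "Re (?B i j)"] abs_trunc_le[of "Im (?B i j)"]
        abs_Re_le_cmod[of "?B i j"] abs_Im_le_cmod[of "?B i j"] by linarith
  qed
  also have "\<dots> \<le> 2 * r * real N"
    using l1_fourier2_le[OF assms] by (simp flip: sum_distrib_left)
  finally have "(\<Sum>p\<in>{..<N} \<times> {..<N} \<times> UNIV. \<bar>?R p\<bar>) \<le> int (nat \<lfloor>2 * r * real N\<rfloor>)"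
    by linarith
  then show ?thesis by (auto simp: int_l1_ball_def rounded_spectrum_def)
qed

text \<open>The set of differing positions is encoded as an integer vector so that the count of
  \<open>int_l1_ball\<close> applies to it too.\<close>

definition entry_diff :: "nat \<Rightarrow> complex mat \<Rightarrow> complex mat \<Rightarrow> nat \<times> nat \<Rightarrow> int" where
  "entry_diff N A B = (\<lambda>p. if p \<in> {..<N} \<times> {..<N} \<and> A $$ p \<noteq> B $$ p then 1 else 0)"

lemma entry_diff_in_ball:
  assumes A: "is_adjacency_mat N A" "fourier_ratio A \<le> r"
    and B: "is_adjacency_mat N B" "fourier_ratio B \<le> r"
    and r: "r \<ge> 0" and eq: "rounded_spectrum N A = rounded_spectrum N B"
  shows "entry_diff N A B \<in> int_l1_ball ({..<N} \<times> {..<N}) (nat \<lfloor>8 * r * real N\<rfloor>)"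
proof -
  let ?a = "fourier2 N (\<lambda>x y. A $$ (x, y))"
  let ?b = "fourier2 N (\<lambda>x y. B $$ (x, y))"
  have entry: "real_of_int \<bar>entry_diff N A B (x, y)\<bar> = (cmod (A $$ (x, y) - B $$ (x, y)))\<^sup>2"
    if "x < N" "y < N" for x y
  proof -
    have "A $$ (x, y) \<in> {0, 1}" "B $$ (x, y) \<in> {0, 1}"
      using A B that by (simp_all add: is_adjacency_mat_def)
    then show ?thesis using that by (auto simp: entry_diff_def)
  qed
  have "real_of_int (\<Sum>p\<in>{..<N} \<times> {..<N}. \<bar>entry_diff N A B p\<bar>)
    = (\<Sum>x<N. \<Sum>y<N. (cmod (A $$ (x, y) - B $$ (x, y)))\<^sup>2)"
    unfolding of_int_sum sum.cartesian_product'
    by (intro sum.cong refl entry) auto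
  also have "\<dots> = (\<Sum>i<N. \<Sum>j<N. (cmod (?a i j - ?b i j))\<^sup>2)"
    by (simp only: fourier2_diff fourier2_Parseval)
  \<comment> \<open>The real and the imaginary part each contribute a factor 2; the two l1-bounds
    \<open>r * N\<close> then give the 8.\<close>
  also have "\<dots> \<le> (\<Sum>i<N. \<Sum>j<N. 4 * cmod (?a i j) + 4 * cmod (?b i j))"
  proof (intro sum_mono)
    fix i j assume "i \<in> {..<N}" "j \<in> {..<N}"
    then have "trunc (Re (?a i j)) = trunc (Re (?b i j))"
      and "trunc (Im (?a i j)) = trunc (Im (?b i j))"
      using fun_cong[OF eq, of "(i, j, True)"] fun_cong[OF eq, of "(i, j, False)"]
      by (simp_all add: rounded_spectrum_def)
    note * = this[THEN trunc_eq_imp_sq_diff_le]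
    have "(cmod (?a i j - ?b i j))\<^sup>2
      = (Re (?a i j) - Re (?b i j))\<^sup>2 + (Im (?a i j) - Im (?b i j))\<^sup>2"
      by (simp add: cmod_power2)
    then show "(cmod (?a i j - ?b i j))\<^sup>2 \<le> 4 * cmod (?a i j) + 4 * cmod (?b i j)"
      using * abs_Re_le_cmod[of "?a i j"] abs_Im_le_cmod[of "?a i j"]
        abs_Re_le_cmod[of "?b i j"] abs_Im_le_cmod[of "?b i j"] by argo
  qed
  also have "\<dots> \<le> 8 * r * real N"
    using l1_fourier2_le[OF A r] l1_fourier2_le[OF B r]
    by (simp add: sum.distrib flip: sum_distrib_left)
  finally have "(\<Sum>p\<in>{..<N} \<times> {..<N}. \<bar>entry_diff N A B p\<bar>) \<le> int (nat \<lfloor>8 * r * real N\<rfloor>)"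
    by linarith
  then show ?thesis by (auto simp: int_l1_ball_def entry_diff_def)
qed

text \<open>With entries in {0, 1}, knowing where a matrix differs from the reference
  \<open>D\<close> determines it.\<close>

lemma adjacency_mat_eqI_entry_diff:
  assumes A: "is_adjacency_mat N A" and B: "is_adjacency_mat N B"
    and eq: "entry_diff N A D = entry_diff N B D" and D: "is_adjacency_mat N D"
  shows "A = B"
proof (rule eq_matI)
  fix i j assume "i < dim_row B" "j < dim_col B"
  then have ij: "i < N" "j < N" using B by (auto simp: is_adjacency_mat_def)
  have "A $$ (i, j) \<in> {0, 1}" "B $$ (i, j) \<in> {0, 1}" "D $$ (i, j) \<in> {0, 1}"
    using A B D ij by (simp_all add: is_adjacency_mat_def)
  then show "A $$ (i, j) = B $$ (i, j)"
    using fun_cong[OF eq, of "(i, j)"] ij by (auto simp: entry_diff_def split: if_splits)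
qed (use A B in \<open>auto simp: is_adjacency_mat_def\<close>)

section \<open>Encoding and counting the graphs\<close>

lemma card_low_FR_graphs_le:
  assumes r: "r \<ge> 0"
  shows "card (low_FR_graphs N q r) \<le>
    (4 * N\<^sup>2 + 1) ^ nat \<lfloor>2 * r * real N\<rfloor> * (2 * N\<^sup>2 + 1) ^ nat \<lfloor>8 * r * real N\<rfloor>"
proof -
  let ?S = "low_FR_graphs N q r"
  let ?I = "{..<N} \<times> {..<N} \<times> (UNIV :: bool set)" and ?J = "{..<N} \<times> {..<N}"
  let ?T = "int_l1_ball ?I (nat \<lfloor>2 * r * real N\<rfloor>)"
  let ?U = "int_l1_ball ?J (nat \<lfloor>8 * r * real N\<rfloor>)"
  \<comment> \<open>The reference depends only on the rounded spectrum, so graphs with equal first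
    code component are compared with the same matrix.\<close>
  define rep where "rep v = (SOME A. A \<in> ?S \<and> rounded_spectrum N A = v)" for v
  define code where
    "code A = (rounded_spectrum N A, entry_diff N A (rep (rounded_spectrum N A)))" for A
  have rep: "rep (rounded_spectrum N A) \<in> ?S"
    "rounded_spectrum N (rep (rounded_spectrum N A)) = rounded_spectrum N A"
    if "A \<in> ?S" for A
    using someI[of "\<lambda>D. D \<in> ?S \<and> rounded_spectrum N D = rounded_spectrum N A" A] that
    by (auto simp: rep_def)
  have "inj_on code ?S"
  proof (rule inj_onI)
    fix A B assume AB: "A \<in> ?S" "B \<in> ?S" and "code A = code B"
    then have "entry_diff N A (rep (rounded_spectrum N A))
      = entry_diff N B (rep (rounded_spectrum N A))"
      by (metis code_def prod.inject)
    then show "A = B"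
      using AB rep(1)[OF AB(1)]
      by (intro adjacency_mat_eqI_entry_diff[of N A B]) (auto simp: low_FR_graphs_def)
  qed
  moreover have "code ` ?S \<subseteq> ?T \<times> ?U"
  proof (rule image_subsetI)
    fix A assume A: "A \<in> ?S"
    note rep_A = rep[OF A]
    have "rounded_spectrum N A \<in> ?T"
      using A r by (intro rounded_spectrum_in_ball) (auto simp: low_FR_graphs_def)
    moreover have "entry_diff N A (rep (rounded_spectrum N A)) \<in> ?U"
      using A rep_A r by (intro entry_diff_in_ball) (auto simp: low_FR_graphs_def)
    ultimately show "code A \<in> ?T \<times> ?U" by (simp add: code_def)
  qed
  \<comment> \<open>The index set has \<open>2 * N\<^sup>2\<close> elements, one for each real or
    imaginary part.\<close>
  moreover have T: "finite ?T" "card ?T \<le> (4 * N\<^sup>2 + 1) ^ nat \<lfloor>2 * r * real N\<rfloor>"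
    using finite_card_int_l1_ball[of ?I "nat \<lfloor>2 * r * real N\<rfloor>"]
    by (simp_all add: card_cartesian_product UNIV_bool power2_eq_square mult_ac)
  moreover have U: "finite ?U" "card ?U \<le> (2 * N\<^sup>2 + 1) ^ nat \<lfloor>8 * r * real N\<rfloor>"
    using finite_card_int_l1_ball[of ?J "nat \<lfloor>8 * r * real N\<rfloor>"]
    by (simp_all add: card_cartesian_product power2_eq_square)
  ultimately have "card ?S \<le> card (?T \<times> ?U)" by (intro card_inj_on_le) auto
  also have "\<dots> \<le> (4 * N\<^sup>2 + 1) ^ nat \<lfloor>2 * r * real N\<rfloor> * (2 * N\<^sup>2 + 1) ^ nat \<lfloor>8 * r * real N\<rfloor>"
    unfolding card_cartesian_product using T U by (intro mult_le_mono)
  finally show ?thesis .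
qed

lemma power_nat_floor_le_powr:
  fixes a b x :: real
  assumes "1 \<le> a" "a \<le> b" "x \<ge> 0"
  shows "a ^ nat \<lfloor>x\<rfloor> \<le> b powr x"
proof -
  have "a ^ nat \<lfloor>x\<rfloor> = a powr real (nat \<lfloor>x\<rfloor>)" using assms by (intro powr_realpow[symmetric]) auto
  also have "\<dots> \<le> a powr x" using assms by (intro powr_mono) linarith+
  also have "\<dots> \<le> b powr x" using assms by (intro powr_mono2) auto
  finally show ?thesis .
qed

lemma card_low_FR_graphs_le_powr:
  assumes N: "N \<ge> 2" and r: "r \<ge> 0"
  shows "real (card (low_FR_graphs N q r)) \<le> real N powr (50 * r * real N)"
proof -
  \<comment> \<open>Both bases are at most \<open>N ^ 5\<close>, and the exponents add up to
    \<open>10 * r * N\<close>; this gives the 50.\<close>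
  have "4 * N\<^sup>2 + 1 \<le> N ^ 5"
  proof -
    have "2 ^ 3 * N\<^sup>2 \<le> N ^ 3 * N\<^sup>2" using N by (intro mult_le_mono1 power_mono) auto
    moreover have "N\<^sup>2 \<ge> 1" using N by simp
    ultimately show ?thesis unfolding power_add[symmetric] by simp
  qed
  then have bound: "real (4 * N\<^sup>2 + 1) \<le> real N ^ 5" by (metis of_nat_le_iff of_nat_power)
  moreover have "real (2 * N\<^sup>2 + 1) \<le> real (4 * N\<^sup>2 + 1)" by simp
  ultimately have bound': "real (2 * N\<^sup>2 + 1) \<le> real N ^ 5" by (rule order_trans[rotated])
  have "real (card (low_FR_graphs N q r)) \<le>
    real (4 * N\<^sup>2 + 1) ^ nat \<lfloor>2 * r * real N\<rfloor> * real (2 * N\<^sup>2 + 1) ^ nat \<lfloor>8 * r * real N\<rfloor>"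
    using card_low_FR_graphs_le[OF r, of N q] by (metis of_nat_le_iff of_nat_mult of_nat_power)
  also have "\<dots> \<le> (real N ^ 5) powr (2 * r * real N) * (real N ^ 5) powr (8 * r * real N)"
    using bound bound' r by (intro mult_mono power_nat_floor_le_powr) auto
  also have "\<dots> = (real N ^ 5) powr (10 * r * real N)" by (simp add: algebra_simps flip: powr_add)
  also have "\<dots> = (real N powr 5) powr (10 * r * real N)" using N by (simp add: powr_numeral)
  also have "\<dots> = real N powr (50 * r * real N)" unfolding powr_powr by (simp add: mult.assoc)
  finally show ?thesis .
qed

theorem theorem4p3:
  shows "\<exists>c C :: real. c > 0 \<and> C > 0 \<and>
    (\<forall>(N :: nat) (r :: real) (q :: nat).
       N \<ge> 2 \<longrightarrow> r \<ge> sqrt 2 \<longrightarrow> r * (ln (real N))\<^sup>2 \<le> c * real N \<longrightarrow>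
       1 \<le> q \<longrightarrow> q \<le> N choose 2 \<longrightarrow>
       real (card (low_FR_graphs N q r)) \<le> 2 powr (C * r * real N * (ln (real N))\<^sup>2))"
proof -
  have "real (card (low_FR_graphs N q r))
      \<le> 2 powr (50 / (ln 2)\<^sup>2 * r * real N * (ln (real N))\<^sup>2)"
    if N: "N \<ge> 2" and "r \<ge> sqrt 2" for N q :: nat and r :: real
  proof -
    have r: "r \<ge> 0" using \<open>r \<ge> sqrt 2\<close> real_sqrt_ge_zero[of 2] by linarith
    have ln_N: "ln (real N) \<ge> ln 2" using N by simp
    have ln2: "ln 2 > (0 :: real)" by simp
    have "real (card (low_FR_graphs N q r)) \<le> real N powr (50 * r * real N)"
      using N r by (rule card_low_FR_graphs_le_powr)
    also have "\<dots> = 2 powr (50 * r * real N * (ln (real N) / ln 2))"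
      using N by (simp add: powr_def)
    \<comment> \<open>The base-2 logarithm of \<open>N\<close> is at least 1, so it is at most its
      square; squaring puts \<open>(ln 2)\<^sup>2\<close> into the constant.\<close>
    also have "\<dots> \<le> 2 powr (50 * r * real N * (ln (real N) / ln 2)\<^sup>2)"
    proof -
      have "ln (real N) / ln 2 \<ge> 1" using ln_N ln2 by (simp add: le_divide_eq)
      then have "ln (real N) / ln 2 \<le> (ln (real N) / ln 2)\<^sup>2"
        by (rule self_le_power) simp
      then show ?thesis using r by (intro powr_mono mult_left_mono) auto
    qed
    also have "\<dots> = 2 powr (50 / (ln 2)\<^sup>2 * r * real N * (ln (real N))\<^sup>2)"
      by (simp add: power_divide)
    finally show ?thesis .
  qed
  then show ?thesis
    by (intro exI[of _ "1 :: real"] exI[of _ "50 / (ln 2)\<^sup>2 :: real"]) auto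
qed

end
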